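(* Let $\triangle P_1P_2P_3$ be a (closed, filled) triangle in $D$. If for all $i,j,k$ with $\{i,j,k\}=\{1,2,3\}$ one has $\Delta_2'(P_i,P_j)>\delta(P_i,P_j,P_k)$, then $\rho(\psi_{\triangle P_1P_2P_3})>\frac{2}{5}$.
   Context: $D$ is the open unit disk in $\mathbb R^2$, $S^1$ its boundary circle identified with $\mathbb R/\mathbb Z$ via the counterclockwise normalized angle. For a closed convex $U\subset D$ and $v\in S^1$, $\psi_U(v)$ is the point $w\in S^1\setminus\{v\}$ such that the line $vw$ meets $U$ and $U$ lies in the closed half-plane to the left of the directed line from $v$ to $w$; it is an orientation-preserving homeomorphism of $S^1$. For such $f$, $\rho(f)=\lim_{n\to\infty}(\overline f^n(x)-x)/n$ with $\overline f$ the lift to $\mathbb R$ satisfying $\overline f(0)\in[0,1)$. Regard $D$ as the Beltrami–Klein model (hyperbolic lines are chords). For distinct $P,Q\in D$ with chord endpoints $v_1,v_2\in S^1$, $d'(P,Q)=\tfrac12\left|\log\frac{|v_1Q||v_2P|}{|v_1P||v_2Q|}\right|$; $\Delta_n'(P,Q)=\log\frac{e^{n d'(P,Q)}+1}{e^{n d'(P,Q)}-1}$ for $n\in\mathbb Z_{>0}$; $\delta(P,Q,R)=\min\{d'(R,S): S \text{ on the chord through } P,Q\}$. *)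

theory Defs
  imports "HOL-Analysis.Analysis"
begin

text \<open>The plane is modelled by the complex numbers; D is the open unit disk ball 0 1,
  its boundary circle is sphere 0 1.  The circle is identified with R/Z via
  t maps to cis (2 pi t) (counterclockwise normalized angle).\<close>

definition circ :: "real \<Rightarrow> complex" where
  "circ t = cis (2 * pi * t)"

definition line_through :: "complex \<Rightarrow> complex \<Rightarrow> complex set" where
  "line_through a b = {a + of_real t * (b - a) | t. True}"

definition left_of :: "complex \<Rightarrow> complex \<Rightarrow> complex \<Rightarrow> bool" where
  "left_of v w u \<longleftrightarrow> Im (cnj (w - v) * (u - v)) \<ge> 0"

definition psi :: "complex set \<Rightarrow> complex \<Rightarrow> complex" where
  "psi U v = (THE w. w \<in> sphere 0 1 \<and> w \<noteq> v \<and> line_through v w \<inter> U \<noteq> {}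
                 \<and> (\<forall>u\<in>U. left_of v w u))"

definition is_lift :: "(complex \<Rightarrow> complex) \<Rightarrow> (real \<Rightarrow> real) \<Rightarrow> bool" where
  "is_lift f F \<longleftrightarrow> continuous_on UNIV F \<and> (\<forall>x. F (x + 1) = F x + 1)
     \<and> (\<forall>x. circ (F x) = f (circ x)) \<and> 0 \<le> F 0 \<and> F 0 < 1"

definition rot_num :: "(complex \<Rightarrow> complex) \<Rightarrow> real" where
  "rot_num f = lim (\<lambda>n. (((THE F. is_lift f F) ^^ n) 0 - 0) / real n)"

definition dK :: "complex \<Rightarrow> complex \<Rightarrow> real" where
  "dK P Q = (THE r. \<exists>v1 v2. v1 \<noteq> v2 \<and> v1 \<in> sphere 0 1 \<and> v2 \<in> sphere 0 1
      \<and> v1 \<in> line_through P Q \<and> v2 \<in> line_through P Q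
      \<and> r = \<bar>ln ((cmod (Q - v1) * cmod (P - v2)) / (cmod (P - v1) * cmod (Q - v2)))\<bar> / 2)"

definition DeltaK :: "nat \<Rightarrow> complex \<Rightarrow> complex \<Rightarrow> real" where
  "DeltaK n P Q = ln ((exp (real n * dK P Q) + 1) / (exp (real n * dK P Q) - 1))"

definition deltaK :: "complex \<Rightarrow> complex \<Rightarrow> complex \<Rightarrow> real" where
  "deltaK P Q R = Inf {dK R S | S. S \<in> ball 0 1 \<and> S \<in> line_through P Q}"

end

theory Submission
  imports Defs
begin

text \<open>
  The second endpoint of the chord from v through a point C of the disk is the image of v under the
  hyperbolic half-turn about C. Let S_i be the lift to the real line of the half-turn about P_i with
  \<open>x < S_i x < x + 1\<close>; it is increasing, and \<open>S_i (S_i x) = x + 1\<close>. The lift of psi for the triangle is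
  F = min (S_1, S_2, S_3), so it suffices that every composition of five of the S_i exceeds \<open>x + 2\<close>.

  This property is invariant under cyclic rotation of the word, and equal neighbours cancel to a shift
  by 1. So only the words ijijk and, after a cancellation, ijk with distinct letters remain. The
  first one is the square of a translation along the line P_i P_j followed by the half-turn about P_k.
  By a trace computation in SU(1,1) it has no fixed point on the circle iff
  \<open>sinh \<delta> * sinh (2 * d) < 1\<close>, where d is the distance of P_i and P_j and \<open>\<delta>\<close> the distance of P_k from
  their line; this is the hypothesis. Without fixed points, continuity
  decides the sign of the composition minus \<open>x + 2\<close> at an endpoint of the chord P_i P_j.
\<close>

subsection \<open>Half-turns and their compositions\<close>

text \<open>The chord with endpoints v and w on the unit circle is given by \<open>z + v * w * cnj z = v + w\<close>;
  solving for w at z = C gives the second endpoint of the chord from v through C.\<close>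
definition half_turn :: "complex \<Rightarrow> complex \<Rightarrow> complex" where
  "half_turn C v = (C - v) / (1 - cnj C * v)"

text \<open>The action of the matrix with rows \<open>(\<alpha>, \<beta>)\<close> and \<open>(cnj \<beta>, cnj \<alpha>)\<close>, a multiple of an
  element of SU(1,1).\<close>
definition su_act :: "complex \<Rightarrow> complex \<Rightarrow> complex \<Rightarrow> complex" where
  "su_act \<alpha> \<beta> v = (\<alpha> * v + \<beta>) / (cnj \<beta> * v + cnj \<alpha>)"

lemma one_minus_norm_square_pos:
  fixes A :: "'a::real_normed_vector"
  assumes "norm A < 1"
  shows "1 - (norm A)\<^sup>2 > 0"
  using assms by (simp add: power_less_one_iff)

lemma half_turn_denominator:
  assumes "cmod C < 1" "cmod v = 1"
  shows "1 - cnj C * v \<noteq> 0"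
proof
  assume "1 - cnj C * v = 0"
  then have "cmod (cnj C * v) = 1" by simp
  with assms show False by (simp add: norm_mult)
qed

lemma norm_half_turn:
  assumes "cmod C < 1" "cmod v = 1"
  shows "cmod (half_turn C v) = 1"
proof -
  have "v * cnj v = 1" using assms(2) by (simp add: complex_norm_square[symmetric])
  then have "1 - cnj C * v = v * cnj (v - C)" by (simp add: algebra_simps)
  then have "cmod (1 - cnj C * v) = cmod (C - v)"
    using assms(2) by (simp only: norm_mult complex_mod_cnj norm_minus_commute)
  then show ?thesis
    using half_turn_denominator[OF assms] by (auto simp: half_turn_def norm_divide)
qed

text \<open>The rows \<open>(-1, C)\<close> and \<open>(- cnj C, 1)\<close> read off from the
  fraction have the wrong relative sign for \<open>su_act\<close>; scaling both by
  \<open>\<i>\<close> repairs this. The trace stays 0.\<close>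

lemma half_turn_su_act: "half_turn C v = su_act (- \<i>) (\<i> * C) v"
proof -
  have "(C - v) / (1 - cnj C * v) = (\<i> * (C - v)) / (\<i> * (1 - cnj C * v))" by simp
  then show ?thesis by (simp add: half_turn_def su_act_def algebra_simps)
qed

lemma su_act_denominator:
  assumes "cmod \<beta> < cmod \<alpha>" "cmod v = 1"
  shows "cnj \<beta> * v + cnj \<alpha> \<noteq> 0"
proof
  assume "cnj \<beta> * v + cnj \<alpha> = 0"
  then have "cmod (cnj \<beta> * v) = cmod (cnj \<alpha>)" by (metis add_eq_0_iff norm_minus_cancel)
  with assms show False by (simp add: norm_mult)
qed

lemma su_act_compose:
  assumes "cmod \<delta> < cmod \<gamma>" "cmod v = 1"
  shows "su_act \<alpha> \<beta> (su_act \<gamma> \<delta> v) = su_act (\<alpha> * \<gamma> + \<beta> * cnj \<delta>) (\<alpha> * \<delta> + \<beta> * cnj \<gamma>) v"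
proof -
  define d where "d = cnj \<delta> * v + cnj \<gamma>"
  have d: "d \<noteq> 0" using su_act_denominator[OF assms] by (simp add: d_def)
  have "su_act \<alpha> \<beta> (su_act \<gamma> \<delta> v)
      = (\<alpha> * ((\<gamma> * v + \<delta>) / d) + \<beta>) / (cnj \<beta> * ((\<gamma> * v + \<delta>) / d) + cnj \<alpha>)"
    by (simp add: su_act_def d_def)
  also have "\<dots> = ((\<alpha> * (\<gamma> * v + \<delta>) + \<beta> * d) / d) / ((cnj \<beta> * (\<gamma> * v + \<delta>) + cnj \<alpha> * d) / d)"
  proof -
    have "\<alpha> * ((\<gamma> * v + \<delta>) / d) + \<beta> = (\<alpha> * (\<gamma> * v + \<delta>) + \<beta> * d) / d"
      "cnj \<beta> * ((\<gamma> * v + \<delta>) / d) + cnj \<alpha> = (cnj \<beta> * (\<gamma> * v + \<delta>) + cnj \<alpha> * d) / d"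
      using d by (simp_all add: field_simps)
    then show ?thesis by simp
  qed
  also have "\<dots> = (\<alpha> * (\<gamma> * v + \<delta>) + \<beta> * d) / (cnj \<beta> * (\<gamma> * v + \<delta>) + cnj \<alpha> * d)"
    using d by simp
  finally show ?thesis by (simp add: su_act_def d_def algebra_simps)
qed

text \<open>Multiplicativity of the determinant: a word in half-turns has as determinant the product
  of the determinants of its letters.\<close>

lemma su_det_compose:
  "(cmod (\<alpha> * \<gamma> + \<beta> * cnj \<delta>))\<^sup>2 - (cmod (\<alpha> * \<delta> + \<beta> * cnj \<gamma>))\<^sup>2
    = ((cmod \<alpha>)\<^sup>2 - (cmod \<beta>)\<^sup>2) * ((cmod \<gamma>)\<^sup>2 - (cmod \<delta>)\<^sup>2)"
  by (simp add: cmod_power2) (algebra)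

text \<open>In other words, an element of SU(1,1) with a fixed point on the circle is not elliptic.\<close>
lemma su_act_fixed_point:
  assumes "cmod \<beta> < cmod \<alpha>" "cmod v = 1" "su_act \<alpha> \<beta> v = v"
  shows "(cmod \<alpha>)\<^sup>2 - (cmod \<beta>)\<^sup>2 \<le> (Re \<alpha>)\<^sup>2"
proof -
  have vv: "v * cnj v = 1" using assms(2) by (simp add: complex_norm_square[symmetric])
  have "\<alpha> * v + \<beta> = v * (cnj \<beta> * v + cnj \<alpha>)"
    using assms(3) su_act_denominator[OF assms(1,2)] by (simp add: su_act_def field_simps)
  then have "cnj v * (\<alpha> * v + \<beta>) = cnj v * (v * (cnj \<beta> * v + cnj \<alpha>))" by simp
  then have "\<alpha> * (v * cnj v) + \<beta> * cnj v = (v * cnj v) * (cnj \<beta> * v + cnj \<alpha>)"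
    by (simp add: algebra_simps)
  then have "\<alpha> + \<beta> * cnj v = cnj \<beta> * v + cnj \<alpha>" by (simp add: vv)
  \<comment> \<open>The two sides are conjugate to each other, so the equation says that
    \<open>\<alpha> + \<beta> * cnj v\<close> is real.\<close>
  then have "Im \<alpha> = - Im (\<beta> * cnj v)" by (simp add: complex_eq_iff mult.commute)
  then have "\<bar>Im \<alpha>\<bar> \<le> cmod (\<beta> * cnj v)" using abs_Im_le_cmod[of "\<beta> * cnj v"] by simp
  then have "\<bar>Im \<alpha>\<bar> \<le> cmod \<beta>" using assms(2) by (simp add: norm_mult)
  then have "(Im \<alpha>)\<^sup>2 \<le> (cmod \<beta>)\<^sup>2" by (metis abs_ge_zero power2_abs power_mono)
  then show ?thesis by (simp add: cmod_power2)
qed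

text \<open>Twice the signed Euclidean area of the triangle. It is also half the trace of the
  product of the three half-turn matrices.\<close>

definition tri_det :: "complex \<Rightarrow> complex \<Rightarrow> complex \<Rightarrow> real" where
  "tri_det A B C = Im (cnj (B - A) * (C - A))"

section \<open>Composites of two, three and five half-turns\<close>

lemma su_norm_less_iff: "cmod \<beta> < cmod \<alpha> \<longleftrightarrow> (cmod \<alpha>)\<^sup>2 - (cmod \<beta>)\<^sup>2 > 0"
  using power_mono_iff[of "cmod \<alpha>" "cmod \<beta>" 2] by (simp add: not_le[symmetric])

lemma half_turn2_su_act:
  assumes "cmod A < 1" "cmod v = 1"
  shows "half_turn B (half_turn A v) = su_act (B * cnj A - 1) (A - B) v"
  using assms by (simp add: half_turn_su_act su_act_compose norm_mult algebra_simps)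

lemma half_turn2_det:
  "(cmod (B * cnj A - 1))\<^sup>2 - (cmod (A - B))\<^sup>2 = (1 - (cmod A)\<^sup>2) * (1 - (cmod B)\<^sup>2)"
  by (simp add: cmod_power2) (algebra)

lemma half_turn2_norm_less:
  assumes "cmod A < 1" "cmod B < 1"
  shows "cmod (A - B) < cmod (B * cnj A - 1)"
  unfolding su_norm_less_iff half_turn2_det using assms by (simp add: power_less_one_iff)

text \<open>The composition is \<open>su_act \<alpha> \<beta>\<close> with half-trace
  \<open>tri_det A B C\<close> and determinant the right-hand side of \<open>small\<close>. The
  hypothesis makes it elliptic, and an elliptic map fixes no point of the circle.\<close>

lemma half_turn3_no_fixed_point:
  assumes "cmod A < 1" "cmod B < 1" "cmod C < 1" "cmod v = 1"
    and small: "(tri_det A B C)\<^sup>2 < (1 - (cmod A)\<^sup>2) * (1 - (cmod B)\<^sup>2) * (1 - (cmod C)\<^sup>2)"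
  shows "half_turn C (half_turn B (half_turn A v)) \<noteq> v"
proof
  assume fixp: "half_turn C (half_turn B (half_turn A v)) = v"
  define \<gamma> \<delta> where "\<gamma> = B * cnj A - 1" and "\<delta> = A - B"
  define \<alpha> \<beta> where "\<alpha> = - \<i> * \<gamma> + \<i> * C * cnj \<delta>" and "\<beta> = - \<i> * \<delta> + \<i> * C * cnj \<gamma>"
  have "half_turn C (half_turn B (half_turn A v)) = su_act \<alpha> \<beta> v"
    using half_turn2_norm_less[OF assms(1,2)]
    by (simp add: half_turn2_su_act assms half_turn_su_act[of C] su_act_compose \<alpha>_def \<beta>_def \<gamma>_def \<delta>_def)
  with fixp have fixp': "su_act \<alpha> \<beta> v = v" by simp
  have det: "(cmod \<alpha>)\<^sup>2 - (cmod \<beta>)\<^sup>2 = (1 - (cmod A)\<^sup>2) * (1 - (cmod B)\<^sup>2) * (1 - (cmod C)\<^sup>2)"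
    using su_det_compose[of "- \<i>" \<gamma> "\<i> * C" \<delta>] half_turn2_det[of B A]
    by (simp add: \<alpha>_def \<beta>_def \<gamma>_def \<delta>_def norm_mult mult.commute)
  have "Re \<alpha> = tri_det A B C"
    by (simp add: \<alpha>_def \<gamma>_def \<delta>_def tri_det_def algebra_simps)
  then have "(Re \<alpha>)\<^sup>2 = (tri_det A B C)\<^sup>2" by simp
  moreover have "cmod \<beta> < cmod \<alpha>"
    unfolding su_norm_less_iff det using small by (meson le_less_trans zero_le_power2)
  ultimately show False
    using su_act_fixed_point[OF _ \<open>cmod v = 1\<close> fixp'] det small by simp
qed

lemma half_turn5_no_fixed_point:
  assumes "cmod A < 1" "cmod B < 1" "cmod C < 1" "cmod v = 1"
    and small: "4 * (1 - A \<bullet> B)\<^sup>2 * (tri_det A B C)\<^sup>2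
      < (1 - (cmod A)\<^sup>2)\<^sup>2 * (1 - (cmod B)\<^sup>2)\<^sup>2 * (1 - (cmod C)\<^sup>2)"
  shows "half_turn C (half_turn B (half_turn A (half_turn B (half_turn A v)))) \<noteq> v"
proof
  assume fixp: "half_turn C (half_turn B (half_turn A (half_turn B (half_turn A v)))) = v"
  define \<gamma> \<delta> where "\<gamma> = B * cnj A - 1" and "\<delta> = A - B"
  define \<gamma>2 \<delta>2 where "\<gamma>2 = \<gamma> * \<gamma> + \<delta> * cnj \<delta>" and "\<delta>2 = \<gamma> * \<delta> + \<delta> * cnj \<gamma>"
  define \<alpha> \<beta> where "\<alpha> = - \<i> * \<gamma>2 + \<i> * C * cnj \<delta>2" and "\<beta> = - \<i> * \<delta>2 + \<i> * C * cnj \<gamma>2"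
  have less: "cmod \<delta> < cmod \<gamma>"
    using half_turn2_norm_less[OF assms(1,2)] by (simp add: \<gamma>_def \<delta>_def)
  have det2: "(cmod \<gamma>2)\<^sup>2 - (cmod \<delta>2)\<^sup>2 = ((1 - (cmod A)\<^sup>2) * (1 - (cmod B)\<^sup>2))\<^sup>2"
    using su_det_compose[of \<gamma> \<gamma> \<delta> \<delta>] half_turn2_det[of B A]
    by (simp add: \<gamma>2_def \<delta>2_def \<gamma>_def \<delta>_def power2_eq_square)
  have less2: "cmod \<delta>2 < cmod \<gamma>2"
    unfolding su_norm_less_iff det2 
    using one_minus_norm_square_pos[OF assms(1)] one_minus_norm_square_pos[OF assms(2)] by simp
  have unit: "cmod (half_turn B (half_turn A v)) = 1"
    using assms by (simp add: norm_half_turn)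
  have "half_turn C (half_turn B (half_turn A (half_turn B (half_turn A v)))) = su_act \<alpha> \<beta> v"
  proof -
    have once: "half_turn B (half_turn A w) = su_act \<gamma> \<delta> w" if "cmod w = 1" for w
      using half_turn2_su_act[OF assms(1) that] by (simp add: \<gamma>_def \<delta>_def)
    have "half_turn B (half_turn A (half_turn B (half_turn A v))) = su_act \<gamma> \<delta> (su_act \<gamma> \<delta> v)"
      using once[OF unit] once[OF \<open>cmod v = 1\<close>] by simp
    also have "\<dots> = su_act \<gamma>2 \<delta>2 v"
      by (simp add: su_act_compose[OF less \<open>cmod v = 1\<close>] \<gamma>2_def \<delta>2_def)
    finally show ?thesis
      by (simp add: half_turn_su_act[of C] su_act_compose[OF less2 \<open>cmod v = 1\<close>] \<alpha>_def \<beta>_def)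
  qed
  with fixp have fixp': "su_act \<alpha> \<beta> v = v" by simp
  have det: "(cmod \<alpha>)\<^sup>2 - (cmod \<beta>)\<^sup>2 = (1 - (cmod A)\<^sup>2)\<^sup>2 * (1 - (cmod B)\<^sup>2)\<^sup>2 * (1 - (cmod C)\<^sup>2)"
    using su_det_compose[of "- \<i>" \<gamma>2 "\<i> * C" \<delta>2] det2
    by (simp add: \<alpha>_def \<beta>_def norm_mult mult.commute power_mult_distrib)
  \<comment> \<open>By Cayley-Hamilton, tr(H M^2) = tr(M) tr(H M) - det(M) tr(H). Here M is the
    matrix for \<open>A\<close> and \<open>B\<close>, with half-trace
    \<open>- (1 - A \<bullet> B)\<close>, and H is the half-turn about \<open>C\<close>, with trace
    0; the half-trace of H M is \<open>tri_det A B C\<close>.\<close>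
  have "Re \<alpha> = - 2 * (1 - A \<bullet> B) * tri_det A B C"
    by (simp add: \<alpha>_def \<gamma>2_def \<delta>2_def \<gamma>_def \<delta>_def tri_det_def inner_complex_def) (algebra)
  then have "(Re \<alpha>)\<^sup>2 = 4 * (1 - A \<bullet> B)\<^sup>2 * (tri_det A B C)\<^sup>2" by (simp only: power_mult_distrib) simp
  moreover have "cmod \<beta> < cmod \<alpha>"
    unfolding su_norm_less_iff det using small
    by (smt (verit) mult_nonneg_nonneg zero_le_power2)
  ultimately show False
    using su_act_fixed_point[OF _ \<open>cmod v = 1\<close> fixp'] det small by simp
qed

subsection \<open>The Klein metric\<close>

lemma norm_add_scaleR_square:
  fixes P e :: complex
  shows "(cmod (P + of_real t * e))\<^sup>2 = (cmod P)\<^sup>2 + 2 * t * (P \<bullet> e) + t\<^sup>2 * (cmod e)\<^sup>2"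
  by (simp add: cmod_power2 inner_complex_def) (algebra)

lemma chord_parameters:
  fixes P e :: complex
  assumes "cmod P < 1" "e \<noteq> 0"
  shows "\<exists>t1 t2. t1 \<noteq> t2 \<and> cmod (P + of_real t1 * e) = 1 \<and> cmod (P + of_real t2 * e) = 1"
proof -
  define a b c where "a = (cmod e)\<^sup>2" and "b = P \<bullet> e" and "c = 1 - (cmod P)\<^sup>2"
  have "a > 0" "c > 0" using assms by (auto simp: a_def c_def power_less_one_iff)
  define r where "r = sqrt (b\<^sup>2 + a * c)"
  have "b\<^sup>2 + a * c > 0" using \<open>a > 0\<close> \<open>c > 0\<close> by (simp add: add_nonneg_pos)
  then have r: "r > 0" "r\<^sup>2 = b\<^sup>2 + a * c" by (auto simp: r_def)
  have root: "cmod (P + of_real ((s - b) / a) * e) = 1" if "s\<^sup>2 = b\<^sup>2 + a * c" for s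
  proof -
    have "a * ((s - b) / a)\<^sup>2 + 2 * ((s - b) / a) * b - c = 0"
      using \<open>a > 0\<close> that by (simp add: field_simps power2_eq_square)
    then have "(cmod (P + of_real ((s - b) / a) * e))\<^sup>2 = 1"
      unfolding norm_add_scaleR_square a_def[symmetric] b_def[symmetric]
      by (simp add: c_def algebra_simps)
    then show ?thesis by (simp add: power2_eq_1_iff) (smt (verit) norm_ge_zero)
  qed
  have "(r - b) / a \<noteq> (- r - b) / a" using r(1) \<open>a > 0\<close> by simp
  moreover have "cmod (P + of_real ((r - b) / a) * e) = 1" "cmod (P + of_real ((- r - b) / a) * e) = 1"
    by (rule root, simp add: r)+
  ultimately show ?thesis by blast
qed

lemma quadratic_roots_sum_prod:
  fixes a b c x y :: real
  assumes "a \<noteq> 0" "x \<noteq> y" "a * x\<^sup>2 + 2 * b * x = c" "a * y\<^sup>2 + 2 * b * y = c"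
  shows "x + y = - 2 * b / a" "x * y = - c / a"
proof -
  have "(x - y) * (a * (x + y) + 2 * b) = 0"
    using assms(3,4) by (simp add: power2_eq_square algebra_simps)
  then have s: "a * (x + y) + 2 * b = 0" using assms(2) by simp
  then show "x + y = - 2 * b / a" using assms(1) by (simp add: field_simps)
  have "a * (x * y) = x * (a * (x + y) + 2 * b) - (a * x\<^sup>2 + 2 * b * x)"
    by (simp add: power2_eq_square algebra_simps)
  then have "a * (x * y) = - c" using s assms(3) by simp
  then show "x * y = - c / a" using assms(1) by (simp add: field_simps)
qed

lemma cosh_half_ln_square:
  fixes R :: real
  assumes "R > 0"
  shows "(cosh (\<bar>ln R\<bar> / 2))\<^sup>2 = (R + 1)\<^sup>2 / (4 * R)"
proof -
  have "(cosh (\<bar>ln R\<bar> / 2))\<^sup>2 = (cosh (ln R) + 1) / 2"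
    using cosh_double_cosh[of "\<bar>ln R\<bar> / 2"] by (simp add: cosh_real_abs)
  also have "\<dots> = (R + 1)\<^sup>2 / (4 * R)"
    using assms by (simp add: cosh_ln_real field_simps power2_eq_square)
  finally show ?thesis .
qed

text \<open>Exchanging the endpoints inverts the cross ratio \<open>R\<close> and preserves
  \<open>(R + 1)\<^sup>2 / (4 * R)\<close>. The latter is therefore symmetric in the chord
  parameters \<open>t1\<close> and \<open>t2\<close>, and Vieta's formulas eliminate the
  endpoints.\<close>

lemma cosh_cross_ratio:
  fixes P Q v1 v2 :: complex
  assumes P: "cmod P < 1" and Q: "cmod Q < 1" and "P \<noteq> Q" and "v1 \<noteq> v2"
    and v: "cmod v1 = 1" "cmod v2 = 1" "v1 \<in> line_through P Q" "v2 \<in> line_through P Q"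
  shows "(cosh (\<bar>ln ((cmod (Q - v1) * cmod (P - v2)) / (cmod (P - v1) * cmod (Q - v2)))\<bar> / 2))\<^sup>2
    = (1 - P \<bullet> Q)\<^sup>2 / ((1 - (cmod P)\<^sup>2) * (1 - (cmod Q)\<^sup>2))"
proof -
  define e where "e = Q - P"
  have "e \<noteq> 0" using \<open>P \<noteq> Q\<close> by (simp add: e_def)
  obtain t1 t2 where t: "v1 = P + of_real t1 * e" "v2 = P + of_real t2 * e"
    using v by (auto simp: line_through_def e_def)
  define a b c d where "a = (cmod e)\<^sup>2" and "b = P \<bullet> e" and "c = 1 - (cmod P)\<^sup>2" and "d = 1 - (cmod Q)\<^sup>2"
  have pos: "a > 0" "c > 0" "d > 0" using assms \<open>e \<noteq> 0\<close>
    by (auto simp: a_def c_def d_def power_less_one_iff)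
  have quad: "a * t1\<^sup>2 + 2 * b * t1 = c" "a * t2\<^sup>2 + 2 * b * t2 = c"
    using norm_add_scaleR_square[of P t1 e] norm_add_scaleR_square[of P t2 e] v t
    by (simp_all add: a_def b_def c_def algebra_simps)
  have "t1 \<noteq> t2" using t \<open>v1 \<noteq> v2\<close> by auto
  have sum: "t1 + t2 = - 2 * b / a" and prod: "t1 * t2 = - c / a"
    using quadratic_roots_sum_prod[OF _ \<open>t1 \<noteq> t2\<close> quad] pos by auto
  have d: "d = c - 2 * b - a"
    using norm_add_scaleR_square[of P 1 e] by (simp add: a_def b_def c_def d_def e_def)
  have prod': "(1 - t1) * (1 - t2) = - d / a"
  proof -
    have "(1 - t1) * (1 - t2) = 1 - (t1 + t2) + t1 * t2" by (simp add: algebra_simps)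
    also have "\<dots> = - d / a" unfolding sum prod d using pos by (simp add: field_simps)
    finally show ?thesis .
  qed
  have neg: "t1 * t2 < 0" "(1 - t1) * (1 - t2) < 0" unfolding prod prod' using pos by auto
  then have nz: "t1 \<noteq> 0" "t2 \<noteq> 0" "1 - t1 \<noteq> 0" "1 - t2 \<noteq> 0" by auto
  define R where "R = ((1 - t1) * t2) / (t1 * (1 - t2))"
  have Reqn: "R = (t1 * t2) * ((1 - t1) * (1 - t2)) / (t1 * (1 - t2))\<^sup>2"
  proof -
    have "R = ((1 - t1) * t2) * (t1 * (1 - t2)) / (t1 * (1 - t2))\<^sup>2"
      using nz by (simp add: R_def power2_eq_square)
    then show ?thesis by (simp only: ac_simps)
  qed
  have "R > 0" unfolding Reqn using neg nz by (simp add: mult_neg_neg)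
  have diffs: "P - v1 = of_real (- t1) * e" "P - v2 = of_real (- t2) * e"
    "Q - v1 = of_real (1 - t1) * e" "Q - v2 = of_real (1 - t2) * e"
    by (simp_all add: t e_def algebra_simps)
  have "(cmod (Q - v1) * cmod (P - v2)) / (cmod (P - v1) * cmod (Q - v2)) = \<bar>R\<bar>"
    unfolding diffs norm_mult norm_of_real R_def using \<open>e \<noteq> 0\<close>
    by (simp add: abs_mult abs_divide)
  then have ratio: "(cmod (Q - v1) * cmod (P - v2)) / (cmod (P - v1) * cmod (Q - v2)) = R"
    using \<open>R > 0\<close> by simp
  have "(R + 1)\<^sup>2 / (4 * R) = (t1 + t2 - 2 * (t1 * t2))\<^sup>2 / (4 * ((t1 * t2) * ((1 - t1) * (1 - t2))))"
  proof -
    have "R + 1 = (t1 + t2 - 2 * (t1 * t2)) / (t1 * (1 - t2))"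
      using nz by (simp add: R_def field_simps)
    then show ?thesis unfolding Reqn using nz by (simp add: power_divide)
  qed
  also have "\<dots> = (c - b)\<^sup>2 / (c * d)"
    unfolding prod' sum prod using pos by (simp add: field_simps power2_eq_square)
  also have "c - b = 1 - P \<bullet> Q"
    by (simp add: c_def b_def e_def inner_diff_right power2_norm_eq_inner)
  finally show ?thesis unfolding ratio cosh_half_ln_square[OF \<open>R > 0\<close>] by (simp add: c_def d_def)
qed

text \<open>\<open>dK\<close> is a definite description: the chord supplies a value, and any two
  values are nonnegative with equal cosh, hence equal.\<close>

lemma dK_nonneg_cosh:
  fixes P Q :: complex
  assumes "cmod P < 1" "cmod Q < 1" "P \<noteq> Q"
  shows "dK P Q \<ge> 0"
    and "(cosh (dK P Q))\<^sup>2 = (1 - P \<bullet> Q)\<^sup>2 / ((1 - (cmod P)\<^sup>2) * (1 - (cmod Q)\<^sup>2))"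
proof -
  define is_dist where "is_dist r \<longleftrightarrow> (\<exists>v1 v2. v1 \<noteq> v2 \<and> v1 \<in> sphere 0 1 \<and> v2 \<in> sphere 0 1
      \<and> v1 \<in> line_through P Q \<and> v2 \<in> line_through P Q
      \<and> r = \<bar>ln ((cmod (Q - v1) * cmod (P - v2)) / (cmod (P - v1) * cmod (Q - v2)))\<bar> / 2)" for r
  have props: "r \<ge> 0 \<and> (cosh r)\<^sup>2 = (1 - P \<bullet> Q)\<^sup>2 / ((1 - (cmod P)\<^sup>2) * (1 - (cmod Q)\<^sup>2))"
    if "is_dist r" for r
  proof -
    obtain v1 v2 where v: "v1 \<noteq> v2" "cmod v1 = 1" "cmod v2 = 1" "v1 \<in> line_through P Q" "v2 \<in> line_through P Q"
      and r: "r = \<bar>ln ((cmod (Q - v1) * cmod (P - v2)) / (cmod (P - v1) * cmod (Q - v2)))\<bar> / 2"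
      using \<open>is_dist r\<close> unfolding is_dist_def by auto
    show ?thesis using cosh_cross_ratio[OF assms v] unfolding r by simp
  qed
  obtain t1 t2 where "t1 \<noteq> t2" "cmod (P + of_real t1 * (Q - P)) = 1" "cmod (P + of_real t2 * (Q - P)) = 1"
    using chord_parameters[of P "Q - P"] assms by auto
  then have "\<exists>v1 v2. v1 \<noteq> v2 \<and> v1 \<in> sphere 0 1 \<and> v2 \<in> sphere 0 1
      \<and> v1 \<in> line_through P Q \<and> v2 \<in> line_through P Q"
    using \<open>P \<noteq> Q\<close>
    by (intro exI[of _ "P + of_real t1 * (Q - P)"] exI[of _ "P + of_real t2 * (Q - P)"])
      (auto simp: line_through_def)
  then have "\<exists>r. is_dist r" unfolding is_dist_def by blast
  moreover have "r = s" if "is_dist r" "is_dist s" for r s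
  proof -
    have "cosh r = cosh s"
      using props[OF that(1)] props[OF that(2)] cosh_real_nonneg[of r] cosh_real_nonneg[of s]
      by (metis power2_eq_iff_nonneg)
    then show ?thesis using props[OF that(1)] props[OF that(2)] arcosh_cosh_real by metis
  qed
  ultimately have "is_dist (THE r. is_dist r)" by (metis theI)
  moreover have "dK P Q = (THE r. is_dist r)" by (simp add: dK_def is_dist_def)
  ultimately have "is_dist (dK P Q)" by simp
  from props[OF this] show "dK P Q \<ge> 0"
    "(cosh (dK P Q))\<^sup>2 = (1 - P \<bullet> Q)\<^sup>2 / ((1 - (cmod P)\<^sup>2) * (1 - (cmod Q)\<^sup>2))" by auto
qed

text \<open>The Klein metric at S, up to the factor \<open>(1 - (cmod S)\<^sup>2)\<^sup>2\<close>.\<close>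
definition klein_form :: "complex \<Rightarrow> complex \<Rightarrow> real" where
  "klein_form S e = (cmod e)\<^sup>2 - (Im (cnj S * e))\<^sup>2"

lemma klein_form_chord:
  "klein_form P (Q - P) = (1 - P \<bullet> Q)\<^sup>2 - (1 - (cmod P)\<^sup>2) * (1 - (cmod Q)\<^sup>2)"
  by (simp add: klein_form_def cmod_power2 inner_complex_def) (algebra)

text \<open>Lets the base point slide from \<open>A\<close> to any other point of the line, because
  \<open>cnj e * e\<close> is real.\<close>

lemma klein_form_along_line:
  "klein_form (A + of_real t * e) e = klein_form A e"
  by (simp add: klein_form_def algebra_simps)

text \<open>Cauchy-Schwarz for the quadratic form \<open>klein_form S\<close>, whose determinant is
  \<open>1 - (cmod S)\<^sup>2\<close>. Equality means that \<open>e\<close> and \<open>f\<close> are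
  orthogonal in the Klein metric at \<open>S\<close>.\<close>

lemma klein_form_gram:
  "klein_form S e * klein_form S f \<ge> (1 - (cmod S)\<^sup>2) * (Im (cnj e * f))\<^sup>2"
proof -
  have "klein_form S e * klein_form S f = (1 - (cmod S)\<^sup>2) * (Im (cnj e * f))\<^sup>2
      + (e \<bullet> f - Im (cnj S * e) * Im (cnj S * f))\<^sup>2"
    by (simp add: klein_form_def cmod_power2 inner_complex_def) (algebra)
  then show ?thesis by simp
qed

section \<open>Distances through hyperbolic sines\<close>

lemma sinh_dK_square:
  assumes "cmod P < 1" "cmod Q < 1" "P \<noteq> Q"
  shows "(sinh (dK P Q))\<^sup>2 = klein_form P (Q - P) / ((1 - (cmod P)\<^sup>2) * (1 - (cmod Q)\<^sup>2))"
proof -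
  have "(cmod P)\<^sup>2 < 1" "(cmod Q)\<^sup>2 < 1" using assms by (simp_all add: power_less_one_iff)
  then show ?thesis
    using dK_nonneg_cosh(2)[OF assms] cosh_square_eq[of "dK P Q"]
    by (simp add: klein_form_chord diff_divide_distrib)
qed

lemma klein_form_pos:
  assumes "cmod S < 1" "e \<noteq> 0"
  shows "klein_form S e > 0"
proof -
  have "\<bar>Im (cnj S * e)\<bar> \<le> cmod S * cmod e" by (metis abs_Im_le_cmod complex_mod_cnj norm_mult)
  also have "\<dots> < cmod e" using assms by simp
  finally have "(Im (cnj S * e))\<^sup>2 < (cmod e)\<^sup>2" by (metis abs_ge_zero power2_abs power_strict_mono zero_less_numeral)
  then show ?thesis by (simp add: klein_form_def)
qed

text \<open>The logarithm is the length whose hyperbolic sine is \<open>1 / sinh (2 * d)\<close>.\<close>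
lemma sinh_less_of_less_Delta:
  fixes d r :: real
  assumes "d > 0" "r < ln ((exp (2 * d) + 1) / (exp (2 * d) - 1))"
  shows "sinh r * (2 * sinh d * cosh d) < 1"
proof -
  define E where "E = exp (2 * d)"
  have "E > 1" using assms(1) by (simp add: E_def)
  have "sinh r < sinh (ln ((E + 1) / (E - 1)))" using assms(2) by (simp add: E_def)
  also have "\<dots> = 2 * E / (E\<^sup>2 - 1)"
  proof -
    have "E\<^sup>2 - 1 = (E - 1) * (E + 1)" by (simp add: power2_eq_square algebra_simps)
    moreover have "E + 1 \<noteq> 0" "E - 1 \<noteq> 0" using \<open>E > 1\<close> by auto
    ultimately show ?thesis using \<open>E > 1\<close>
      by (simp add: sinh_ln_real divide_simps) (simp add: algebra_simps power2_eq_square)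
  qed
  finally have less: "sinh r < 2 * E / (E\<^sup>2 - 1)" .
  have "2 * sinh d * cosh d = sinh (2 * d)" by (simp add: sinh_double)
  also have "\<dots> = (E\<^sup>2 - 1) / (2 * E)"
    by (simp add: sinh_field_def E_def exp_minus field_simps power2_eq_square)
  finally have eq: "2 * sinh d * cosh d = (E\<^sup>2 - 1) / (2 * E)" .
  have "E\<^sup>2 - 1 > 0" using \<open>E > 1\<close> by (simp add: one_less_power)
  then show ?thesis using less \<open>E > 1\<close> unfolding eq by (simp add: field_simps)
qed

text \<open>For every point \<open>S\<close> of the chord, the Gram inequality bounds
  \<open>sinh (dK C S)\<close> from below by the sinh of the distance from \<open>C\<close> to the
  line. So any \<open>S\<close> closer to \<open>C\<close> than \<open>DeltaK 2 A B\<close>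
  suffices, and the foot of the perpendicular is never constructed.\<close>

lemma Delta_delta_imp_tri_det:
  fixes A B C :: complex
  assumes "cmod A < 1" "cmod B < 1" "cmod C < 1" "tri_det A B C \<noteq> 0"
    and hyp: "DeltaK 2 A B > deltaK A B C"
  shows "4 * (1 - A \<bullet> B)\<^sup>2 * (tri_det A B C)\<^sup>2
      < (1 - (cmod A)\<^sup>2)\<^sup>2 * (1 - (cmod B)\<^sup>2)\<^sup>2 * (1 - (cmod C)\<^sup>2)"
proof -
  have "A \<noteq> B" using assms(4) by (auto simp: tri_det_def)
  have "\<exists>S. cmod S < 1 \<and> S \<in> line_through A B \<and> dK C S < DeltaK 2 A B"
  proof (rule ccontr)
    assume no: "\<not> ?thesis"
    have "A \<in> line_through A B" unfolding line_through_def by (auto intro: exI[of _ 0])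
    then have "{dK C S | S. S \<in> ball 0 1 \<and> S \<in> line_through A B} \<noteq> {}"
      using assms(1) by auto
    then have "DeltaK 2 A B \<le> deltaK A B C"
      unfolding deltaK_def using no by (rule_tac cInf_greatest) (auto simp: not_less)
    with hyp show False by simp
  qed
  then obtain t where S: "cmod (A + of_real t * (B - A)) < 1"
    and less: "dK C (A + of_real t * (B - A)) < DeltaK 2 A B"
    by (auto simp: line_through_def)
  define S e where "S = A + of_real t * (B - A)" and "e = B - A"
  note S = S[folded S_def] and less = less[folded S_def]
  define f where "f = C - S"
  have cross: "tri_det A B C = Im (cnj e * f)"
    by (simp add: tri_det_def e_def f_def S_def algebra_simps)
  \<comment> \<open>\<open>dK\<close> has a meaningful value only for distinct points; the nonzero
    determinant keeps \<open>C\<close> off the line.\<close>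
  have "C \<noteq> S" using assms(4) cross by (auto simp: f_def)
  define d where "d = dK A B"
  define nA nB nC nS where "nA = 1 - (cmod A)\<^sup>2" and "nB = 1 - (cmod B)\<^sup>2"
    and "nC = 1 - (cmod C)\<^sup>2" and "nS = 1 - (cmod S)\<^sup>2"
  have pos: "nA > 0" "nB > 0" "nC > 0" "nS > 0"
    using assms S by (auto simp: nA_def nB_def nC_def nS_def power_less_one_iff)
  have sinhd: "(sinh d)\<^sup>2 = klein_form S e / (nA * nB)"
    using sinh_dK_square[OF assms(1,2) \<open>A \<noteq> B\<close>] klein_form_along_line[of A t "B - A"]
    by (simp add: d_def nA_def nB_def S_def e_def)
  have coshd: "(cosh d)\<^sup>2 = (1 - A \<bullet> B)\<^sup>2 / (nA * nB)"
    using dK_nonneg_cosh(2)[OF assms(1,2) \<open>A \<noteq> B\<close>] by (simp add: d_def nA_def nB_def)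
  have sinhr: "(sinh (dK C S))\<^sup>2 = klein_form S f / (nC * nS)"
  proof -
    have "klein_form C (S - C) = klein_form S (C - S)"
      by (simp only: klein_form_chord) (simp add: inner_commute mult.commute)
    then show ?thesis using sinh_dK_square[OF assms(3) S \<open>C \<noteq> S\<close>] by (simp add: nC_def nS_def f_def)
  qed
  have "klein_form S e > 0" using klein_form_pos[OF S] \<open>A \<noteq> B\<close> by (simp add: e_def)
  then have "sinh d \<noteq> 0" using sinhd pos by auto
  then have "d > 0" using dK_nonneg_cosh(1)[OF assms(1,2) \<open>A \<noteq> B\<close>] by (cases "d = 0") (auto simp: d_def)
  have "sinh (dK C S) \<ge> 0" using dK_nonneg_cosh(1)[OF assms(3) S \<open>C \<noteq> S\<close>] by simp
  moreover have "sinh (dK C S) * (2 * sinh d * cosh d) < 1"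
    by (rule sinh_less_of_less_Delta[OF \<open>d > 0\<close>]) (use less in \<open>simp add: DeltaK_def d_def\<close>)
  ultimately have "(sinh (dK C S) * (2 * sinh d * cosh d))\<^sup>2 < 1"
    using \<open>d > 0\<close> by (simp add: power_less_one_iff abs_square_less_1)
  then have "(sinh (dK C S))\<^sup>2 * (4 * (sinh d)\<^sup>2 * (cosh d)\<^sup>2) < 1" by (simp add: power_mult_distrib)
  then have "4 * (1 - A \<bullet> B)\<^sup>2 * (klein_form S e * klein_form S f) < nA\<^sup>2 * nB\<^sup>2 * nC * nS"
    unfolding sinhd coshd sinhr using pos by (simp add: field_simps power2_eq_square)
  \<comment> \<open>The factor \<open>nS\<close> of the Gram inequality cancels the one coming from
    \<open>sinhr\<close>, so the auxiliary point disappears from the estimate.\<close>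
  moreover have "4 * (1 - A \<bullet> B)\<^sup>2 * (nS * (tri_det A B C)\<^sup>2)
      \<le> 4 * (1 - A \<bullet> B)\<^sup>2 * (klein_form S e * klein_form S f)"
    unfolding cross nS_def by (intro mult_left_mono klein_form_gram) auto
  ultimately have "4 * (1 - A \<bullet> B)\<^sup>2 * (tri_det A B C)\<^sup>2 * nS < nA\<^sup>2 * nB\<^sup>2 * nC * nS"
    by (simp add: algebra_simps)
  then show ?thesis using pos unfolding nA_def nB_def nC_def by simp
qed

subsection \<open>Translation numbers\<close>

lemma funpow_degree_one:
  fixes F :: "real \<Rightarrow> real"
  assumes "\<And>x. F (x + 1) = F x + 1"
  shows "(F ^^ n) (x + 1) = (F ^^ n) x + 1"
  by (induction n) (auto simp: assms)

lemma degree_one_add_int: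
  fixes F :: "real \<Rightarrow> real"
  assumes "\<And>x. F (x + 1) = F x + 1"
  shows "F (x + of_int k) = F x + of_int k"
proof (induction k rule: int_induct[where k = 0])
  case base
  show ?case by simp
next
  case (step1 i)
  then show ?case using assms[of "x + of_int i"] by (simp add: algebra_simps)
next
  case (step2 i)
  then show ?case using assms[of "x + of_int i - 1"] by (simp add: algebra_simps)
qed

text \<open>At integers the displacement equals \<open>F 0\<close>; monotonicity handles
  \<open>y\<close> by sandwiching it between consecutive integers.\<close>

lemma degree_one_displacement:
  fixes F :: "real \<Rightarrow> real"
  assumes "mono F" "\<And>x. F (x + 1) = F x + 1"
  shows "\<bar>F y - y - F 0\<bar> \<le> 1"
proof -
  have at_int: "F (of_int k) = F 0 + of_int k" for k
    using degree_one_add_int[of F 0 k] assms(2) by simp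
  have "F (of_int \<lfloor>y\<rfloor>) \<le> F y" "F y \<le> F (of_int (\<lfloor>y\<rfloor> + 1))"
    by (rule monoD[OF \<open>mono F\<close>], linarith)+
  then have "F 0 + of_int \<lfloor>y\<rfloor> \<le> F y" "F y \<le> F 0 + (of_int \<lfloor>y\<rfloor> + 1)"
    unfolding at_int by simp_all
  then show ?thesis by linarith
qed

text \<open>The orbit of 0 is additive in the exponent up to an error of 1. Comparing the averages
  at \<open>m\<close> and at \<open>n\<close> with the one at \<open>m * n\<close> gives a Cauchy
  sequence.\<close>

lemma translation_number_convergent:
  fixes F :: "real \<Rightarrow> real"
  assumes "mono F" and F1: "\<And>x. F (x + 1) = F x + 1"
  shows "convergent (\<lambda>n. (F ^^ n) 0 / real n)"
proof -
  define a where "a n = (F ^^ n) 0" for n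
  have quasi: "\<bar>a (m + n) - a n - a m\<bar> \<le> 1" for m n
    using degree_one_displacement[of "F ^^ m" "a n"] funpow_degree_one[of F] F1
      mono_pow[OF \<open>mono F\<close>]
    by (simp add: a_def funpow_add)
  have multiple: "\<bar>a (k * n) - real k * a n\<bar> \<le> real k" for k n
  proof (induction k)
    case 0
    show ?case by (simp add: a_def)
  next
    case (Suc k)
    have "Suc k * n = n + k * n" by simp
    then have "\<bar>a (Suc k * n) - a (k * n) - a n\<bar> \<le> 1"
      using quasi[of n "k * n"] by simp
    with Suc show ?case by (simp add: algebra_simps abs_le_iff)
  qed
  have avg: "\<bar>a (k * n) / real (k * n) - a n / real n\<bar> \<le> 1 / real n" if "k > 0" "n > 0" for k n
  proof -
    have "a (k * n) / real (k * n) - a n / real n = (a (k * n) - real k * a n) / real (k * n)"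
      using that by (simp add: field_simps)
    also have "\<bar>\<dots>\<bar> \<le> real k / real (k * n)"
      unfolding abs_divide abs_of_nat by (rule divide_right_mono[OF multiple]) simp
    finally show ?thesis using that by simp
  qed
  have gap: "\<bar>a m / real m - a n / real n\<bar> \<le> 1 / real m + 1 / real n" if "m > 0" "n > 0" for m n
    using avg[of m n] avg[of n m] that by (simp add: mult.commute abs_le_iff)
  have "Cauchy (\<lambda>n. a n / real n)"
  proof (rule metric_CauchyI)
    fix e :: real assume "e > 0"
    obtain N :: nat where N: "2 / e < real N" using reals_Archimedean2 by blast
    have "N > 0" using N \<open>e > 0\<close> by (metis divide_pos_pos gr0I of_nat_0 order_less_asym zero_less_numeral)
    have small: "1 / real m < e / 2" if "m \<ge> N" for m
    proof -
      have "2 / e < real m" using N that by linarith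
      then show ?thesis using \<open>e > 0\<close> \<open>N > 0\<close> that by (simp add: field_simps)
    qed
    show "\<exists>M. \<forall>m\<ge>M. \<forall>n\<ge>M. dist (a m / real m) (a n / real n) < e"
    proof (intro exI allI impI)
      fix m n assume mn: "N \<le> m" "N \<le> n"
      then have "m > 0" "n > 0" using \<open>N > 0\<close> by auto
      from gap[OF this] small[OF mn(1)] small[OF mn(2)]
      show "dist (a m / real m) (a n / real n) < e" by (simp add: dist_real_def)
    qed
  qed
  then show ?thesis by (simp add: a_def Cauchy_convergent_iff)
qed

text \<open>Compactness keeps the inequality strict in the limit: the displacement of
  \<open>F ^^ q\<close> is continuous and periodic, so its minimum \<open>c\<close> still exceeds
  \<open>p\<close>. The bound is then read off along multiples of \<open>q\<close>.\<close>

lemma translation_number_gt: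
  fixes F :: "real \<Rightarrow> real" and p :: real
  assumes "mono F" and F1: "\<And>x. F (x + 1) = F x + 1" and cont: "continuous_on UNIV F"
    and "q > 0" and gt: "\<And>x. (F ^^ q) x > x + p"
  shows "lim (\<lambda>n. (F ^^ n) 0 / real n) > p / real q"
proof -
  define G where "G = F ^^ q"
  have G1: "G (x + 1) = G x + 1" for x
    unfolding G_def by (rule funpow_degree_one) (rule F1)
  have contG: "continuous_on UNIV G"
    unfolding G_def
  proof (induction q)
    case 0
    then show ?case by (simp add: continuous_on_id)
  next
    case (Suc q)
    then show ?case
      by (simp add: o_def continuous_on_compose2[OF cont])
  qed
  have "\<exists>z\<in>{0..1}. \<forall>y\<in>{0..1}. G z - z \<le> G y - y"
    by (rule continuous_attains_inf)
      (auto intro!: continuous_intros continuous_on_subset[OF contG])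
  then obtain z where z: "\<And>y. y \<in> {0..1} \<Longrightarrow> G z - z \<le> G y - y" by blast
  define c where "c = G z - z"
  have "c > p" using gt[of z] by (simp add: c_def G_def)
  have Gc: "G x \<ge> x + c" for x
  proof -
    have "G x = G (frac x) + of_int \<lfloor>x\<rfloor>"
      using degree_one_add_int[of G "frac x" "\<lfloor>x\<rfloor>"] G1 by (simp add: frac_def)
    moreover have "frac x \<in> {0..1}" using frac_lt_1[of x] frac_ge_0[of x] by auto
    ultimately show ?thesis using z[of "frac x"] by (simp add: c_def frac_def)
  qed
  have iter: "(F ^^ (q * k)) 0 \<ge> real k * c" for k
  proof (induction k)
    case (Suc k)
    have "(F ^^ (q * Suc k)) 0 = G ((F ^^ (q * k)) 0)"
      by (simp add: G_def funpow_add)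
    with Gc[of "(F ^^ (q * k)) 0"] Suc show ?case by (simp add: algebra_simps)
  qed simp
  obtain L where L: "(\<lambda>n. (F ^^ n) 0 / real n) \<longlonglongrightarrow> L"
    using translation_number_convergent[of F] assms(1) F1 by (auto simp: convergent_def)
  have "(\<lambda>k. (F ^^ (q * k)) 0 / real (q * k)) \<longlonglongrightarrow> L"
    using LIMSEQ_subseq_LIMSEQ[OF L, of "\<lambda>k. q * k"] \<open>q > 0\<close>
    by (simp add: o_def strict_mono_def)
  moreover have "(F ^^ (q * k)) 0 / real (q * k) \<ge> c / real q" if "k \<ge> 1" for k
    using iter[of k] that \<open>q > 0\<close> by (simp add: field_simps)
  ultimately have "L \<ge> c / real q"
    by (intro LIMSEQ_le_const) auto
  moreover have "c / real q > p / real q" using \<open>c > p\<close> \<open>q > 0\<close> by (simp add: divide_strict_right_mono)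
  ultimately show ?thesis using limI[OF L] by simp
qed

subsection \<open>Lifts of half-turns\<close>

text \<open>With \<open>u = 1 - C * cnj v\<close>, whose real part is positive, \<open>half_turn C v = - v * u / cnj u\<close>.\<close>
definition turn_lift :: "complex \<Rightarrow> real \<Rightarrow> real" where
  "turn_lift C x = x + 1 / 2 + Arg (1 - C * cis (- 2 * pi * x)) / pi"

lemma Re_one_minus_pos:
  assumes "cmod C < 1"
  shows "Re (1 - C * cis t) > 0"
  using complex_Re_le_cmod[of "C * cis t"] assms by (simp add: norm_mult)

section \<open>Real coordinates on the circle\<close>

lemma circ_eq_iff: "circ x = circ y \<longleftrightarrow> (\<exists>k::int. x = y + of_int k)"
proof
  assume "circ x = circ y"
  then have "exp (\<i> * of_real (2 * pi * x)) = exp (\<i> * of_real (2 * pi * y))"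
    by (simp add: circ_def cis_conv_exp)
  then obtain k :: int where "\<i> * of_real (2 * pi * x) = \<i> * of_real (2 * pi * y) + of_real (of_int (2 * k) * pi) * \<i>"
    by (auto simp: exp_eq)
  then have "2 * pi * x = 2 * pi * y + 2 * k * pi"
    by (simp add: complex_eq_iff)
  then have "2 * pi * x = 2 * pi * (y + k)" by (simp add: algebra_simps)
  then show "\<exists>k::int. x = y + of_int k" by auto
next
  assume "\<exists>k::int. x = y + of_int k"
  then obtain k :: int where "x = y + of_int k" by blast
  then have "2 * pi * x = 2 * pi * y + 2 * pi * of_int k" by (simp add: algebra_simps)
  then show "circ x = circ y" by (simp add: circ_def cis_mult[symmetric] cis_multiple_2pi)
qed

lemma norm_circ [simp]: "cmod (circ x) = 1"
  by (simp add: circ_def)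

lemma sphere_eq_circ:
  assumes "cmod w = 1" "w \<noteq> circ x"
  obtains y where "w = circ y" "x < y" "y < x + 1"
proof -
  define z where "z = Arg w / (2 * pi)"
  have "w = cis (Arg w)" using assms(1) rcis_cmod_Arg[of w] by (simp add: rcis_def)
  then have w: "w = circ z" by (simp add: circ_def z_def)
  define y where "y = x + frac (z - x)"
  have "w = circ y" unfolding w circ_eq_iff y_def frac_def by (auto intro!: exI[of _ "\<lfloor>z - x\<rfloor>"])
  moreover have "frac (z - x) \<noteq> 0" using calculation assms(2) unfolding y_def by (metis add_0_right)
  then have "x < y" "y < x + 1" using frac_ge_0[of "z - x"] frac_lt_1[of "z - x"] by (auto simp: y_def)
  ultimately show ?thesis using that by blast
qed

text \<open>For \<open>x < y < x + 1\<close> the chord from \<open>circ x\<close> to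
  \<open>circ y\<close> has direction \<open>\<i> * cis (pi * (y + x))\<close>. The positive factor
  thus puts \<open>C\<close> on the ray from \<open>circ x\<close> towards
  \<open>circ (turn_lift C x)\<close>.\<close>

lemma circ_Arg_decomposition:
  assumes "cmod C < 1"
  shows "\<exists>\<rho>>0. C - circ x = \<i> * of_real \<rho> * cis (pi * (turn_lift C x + x))"
proof -
  define u where "u = 1 - C * cis (- 2 * pi * x)"
  have "u \<noteq> 0" using Re_one_minus_pos[OF assms, of "- 2 * pi * x"] unfolding u_def by (metis less_irrefl zero_complex.sel(1))
  then have u: "u = of_real (cmod u) * cis (Arg u)"
    using rcis_cmod_Arg[of u] by (simp add: rcis_def)
  have Arg: "Arg u = pi * (turn_lift C x - x) - pi / 2"
    by (simp add: turn_lift_def u_def field_simps)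
  have cis1: "cis (2 * pi * x) * cis (- 2 * pi * x) = 1" by (simp add: cis_mult)
  have "C - circ x = - (cis (2 * pi * x) * u)"
    using cis1 by (simp add: u_def circ_def right_diff_distrib mult.left_commute)
  also have "\<dots> = - (of_real (cmod u) * (cis (2 * pi * x) * cis (Arg u)))"
    by (subst u) (simp add: mult.left_commute)
  also have "cis (2 * pi * x) * cis (Arg u) = cis (pi * (turn_lift C x + x) - pi / 2)"
    by (simp add: cis_mult Arg algebra_simps)
  also have "\<dots> = - \<i> * cis (pi * (turn_lift C x + x))"
    by (simp add: complex_eq_iff cos_diff sin_diff)
  finally show ?thesis using \<open>u \<noteq> 0\<close> by (intro exI[of _ "cmod u"]) simp
qed

lemma turn_lift_bounds:
  assumes "cmod C < 1"
  shows "x < turn_lift C x" "turn_lift C x < x + 1"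
proof -
  have "\<bar>Arg (1 - C * cis (- 2 * pi * x))\<bar> < pi / 2"
    unfolding Arg_Re_pos using Re_one_minus_pos[OF assms] by blast
  then show "x < turn_lift C x" "turn_lift C x < x + 1"
    by (auto simp: turn_lift_def field_simps abs_less_iff)
qed

lemma circ_turn_lift:
  assumes "cmod C < 1"
  shows "circ (turn_lift C x) = half_turn C (circ x)"
proof -
  obtain \<rho> where "\<rho> > 0" and \<rho>: "C - circ x = \<i> * of_real \<rho> * cis (pi * (turn_lift C x + x))"
    using circ_Arg_decomposition[OF assms] by blast
  define s where "s = pi * (turn_lift C x + x)"
  have "circ x * cnj (circ x) = 1" by (simp add: complex_norm_square[symmetric])
  then have "1 - cnj C * circ x = - (circ x * cnj (C - circ x))" by (simp add: algebra_simps)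
  also have "\<dots> = \<i> * of_real \<rho> * (circ x * cis (- s))"
    unfolding \<rho> s_def[symmetric] by (simp add: cis_cnj)
  finally have "half_turn C (circ x) = cis s / (circ x * cis (- s))"
    using \<open>\<rho> > 0\<close> by (simp add: half_turn_def \<rho> s_def[symmetric])
  also have "\<dots> = cis (s - (2 * pi * x - s))" by (simp add: circ_def cis_mult cis_divide)
  also have "s - (2 * pi * x - s) = 2 * pi * turn_lift C x" by (simp add: s_def algebra_simps)
  finally show ?thesis by (simp add: circ_def)
qed

lemma turn_lift_add_one: "turn_lift C (x + 1) = turn_lift C x + 1"
proof -
  have "cis (- 2 * pi * (x + 1)) = cis (- 2 * pi * x)"
    by (simp add: complex_eq_iff algebra_simps cos_diff sin_diff)
  then show ?thesis by (simp add: turn_lift_def)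
qed

lemma continuous_turn_lift:
  assumes "cmod C < 1"
  shows "continuous_on UNIV (turn_lift C)"
proof -
  have "continuous_on UNIV (\<lambda>x. Arg (1 - C * cis (- 2 * pi * x)))"
  proof (rule continuous_on_Arg')
    show "continuous_on UNIV (\<lambda>x. 1 - C * cis (- 2 * pi * x))"
      unfolding cis_conv_exp by (intro continuous_intros)
    show "1 - C * cis (- 2 * pi * x) \<notin> \<real>\<^sub>\<le>\<^sub>0" for x
      using Re_one_minus_pos[OF assms, of "- 2 * pi * x"]
      unfolding complex_nonpos_Reals_iff by linarith
  qed
  then show ?thesis unfolding turn_lift_def
    by (intro continuous_on_add continuous_on_divide continuous_on_id continuous_on_const) auto
qed

lemma half_turn_involution:
  assumes "cmod C < 1" "cmod v = 1"
  shows "half_turn C (half_turn C v) = v"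
proof -
  have "half_turn C (half_turn C v) = su_act (C * cnj C - 1) 0 v"
    using half_turn2_su_act[OF assms] by simp
  moreover have "C * cnj C - 1 = of_real ((cmod C)\<^sup>2 - 1)" by (simp add: complex_norm_square[symmetric])
  moreover have "(cmod C)\<^sup>2 - 1 \<noteq> 0" using one_minus_norm_square_pos[OF assms(1)] by simp
  ultimately show ?thesis by (simp add: su_act_def del: of_real_diff)
qed

text \<open>The lift of an involution squares to an integer shift at each point; the bounds place
  this integer strictly between 0 and 2.\<close>

lemma turn_lift_twice:
  assumes "cmod C < 1"
  shows "turn_lift C (turn_lift C x) = x + 1"
proof -
  have "circ (turn_lift C (turn_lift C x)) = circ x"
    by (simp add: circ_turn_lift assms half_turn_involution)
  then obtain k :: int where k: "turn_lift C (turn_lift C x) = x + of_int k"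
    by (auto simp: circ_eq_iff)
  have "(0::real) < of_int k" "of_int k < (2::real)"
    using turn_lift_bounds[OF assms, of x] turn_lift_bounds[OF assms, of "turn_lift C x"] k by auto
  then have "k = 1" by linarith
  with k show ?thesis by simp
qed

lemma strict_mono_turn_lift:
  assumes "cmod C < 1"
  shows "strict_mono (turn_lift C)"
proof (rule strict_monoI)
  fix x y :: real assume "x < y"
  \<comment> \<open>Continuity and injectivity give monotonicity on the segment from
    \<open>x\<close> to \<open>x + n\<close>, which contains \<open>y\<close>; the shift by
    \<open>n\<close> rules out the decreasing case.\<close>
  obtain n :: nat where n: "y - x < real n" using reals_Archimedean2 by blast
  have "turn_lift C (x + of_int (int n)) = turn_lift C x + of_int (int n)"
    by (rule degree_one_add_int) (rule turn_lift_add_one)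
  moreover have "inj (turn_lift C)"
    by (rule inj_on_inverseI[where g = "\<lambda>y. turn_lift C y - 1"]) (simp add: turn_lift_twice assms)
  ultimately show "turn_lift C x < turn_lift C y"
    using continuous_inj_imp_mono[of x y "x + n" "turn_lift C"] \<open>x < y\<close> n
      continuous_on_subset[OF continuous_turn_lift[OF assms]] inj_on_subset
    by (smt (verit) of_int_of_nat_eq subset_UNIV)
qed

section \<open>The side of a chord on which a point lies\<close>

lemma orientation_turn_lift:
  assumes "cmod C < 1"
  shows "\<exists>\<rho>>0. Im (cnj (circ y - circ x) * (C - circ x))
    = \<rho> * sin (pi * (y - x)) * sin (pi * (turn_lift C x - y))"
proof -
  obtain \<rho> where "\<rho> > 0" and \<rho>: "C - circ x = \<i> * of_real \<rho> * cis (pi * (turn_lift C x + x))"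
    using circ_Arg_decomposition[OF assms] by blast
  have "circ y - circ x = cis (pi * (y + x)) * (cis (pi * (y - x)) - cis (- (pi * (y - x))))"
    by (simp add: circ_def right_diff_distrib cis_mult algebra_simps)
  also have "cis (pi * (y - x)) - cis (- (pi * (y - x))) = 2 * \<i> * of_real (sin (pi * (y - x)))"
    by (simp add: complex_eq_iff)
  finally have chord: "cnj (circ y - circ x) = - 2 * \<i> * of_real (sin (pi * (y - x))) * cis (- (pi * (y + x)))"
    by (simp add: cis_cnj)
  have "cnj (circ y - circ x) * (C - circ x) = of_real (2 * \<rho> * sin (pi * (y - x)))
      * (cis (- (pi * (y + x))) * cis (pi * (turn_lift C x + x)))"
    unfolding chord \<rho> by (simp)
  also have "cis (- (pi * (y + x))) * cis (pi * (turn_lift C x + x)) = cis (pi * (turn_lift C x - y))"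
    by (simp add: cis_mult algebra_simps)
  finally have "Im (cnj (circ y - circ x) * (C - circ x))
      = (2 * \<rho>) * sin (pi * (y - x)) * sin (pi * (turn_lift C x - y))" by simp
  with \<open>\<rho> > 0\<close> show ?thesis by (intro exI[of _ "2 * \<rho>"]) simp
qed

lemma sgn_sin_pi:
  assumes "\<bar>t\<bar> < 1"
  shows "sgn (sin (pi * t)) = sgn t"
proof (cases t "0::real" rule: linorder_cases)
  case less
  then have "sin (pi * (- t)) > 0" using assms mult_strict_left_mono[of "- t" 1 pi]
    by (intro sin_gt_zero) (auto simp: mult_less_0_iff)
  then show ?thesis using less by simp
next
  case greater
  then have "sin (pi * t) > 0" using assms by (intro sin_gt_zero) auto
  then show ?thesis using greater by simp
qed simp

text \<open>Both sine arguments lie strictly between -pi and pi, and the first is positive.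
  Geometrically, \<open>C\<close> is strictly left of the directed chord exactly when the chord
  through \<open>C\<close> ends beyond \<open>y\<close>.\<close>

lemma sgn_orientation_turn_lift:
  assumes "cmod C < 1" "x < y" "y < x + 1"
  shows "sgn (Im (cnj (circ y - circ x) * (C - circ x))) = sgn (turn_lift C x - y)"
proof -
  obtain \<rho> where "\<rho> > 0" "Im (cnj (circ y - circ x) * (C - circ x))
    = \<rho> * sin (pi * (y - x)) * sin (pi * (turn_lift C x - y))"
    using orientation_turn_lift[OF assms(1)] by blast
  moreover have "\<bar>turn_lift C x - y\<bar> < 1" "\<bar>y - x\<bar> < 1"
    using turn_lift_bounds[OF assms(1), of x] assms by auto
  ultimately show ?thesis using assms by (simp add: sgn_mult sgn_sin_pi)
qed

subsection \<open>Words in half-turns\<close>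

text \<open>Words are compared through these properties alone; the geometry enters only through the
  absence of fixed points.\<close>

definition turn_like :: "(real \<Rightarrow> real) \<Rightarrow> bool" where
  "turn_like f \<longleftrightarrow> continuous_on UNIV f \<and> strict_mono f \<and> (\<forall>x. x < f x) \<and> (\<forall>x. f (f x) = x + 1)"

lemma turn_like_turn_lift: "cmod C < 1 \<Longrightarrow> turn_like (turn_lift C)"
  by (simp add: turn_like_def continuous_turn_lift strict_mono_turn_lift turn_lift_bounds turn_lift_twice)

lemma turn_like_add_one:
  assumes "turn_like f"
  shows "f (x + 1) = f x + 1"
  using assms unfolding turn_like_def by metis

text \<open>Applying \<open>g\<close> to the comparison of \<open>f 0\<close> with
  \<open>g 0\<close> reverses it at \<open>f 0\<close>, because \<open>f (f 0)\<close> and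
  \<open>g (g 0)\<close> are both 1. The intermediate value theorem gives a coincidence in
  between.\<close>

lemma turn_like_coincide:
  assumes f: "turn_like f" and g: "turn_like g"
  shows "\<exists>x. f x = g x"
proof -
  define h where "h x = f x - g x" for x
  have cont: "continuous_on {0..f 0} h"
    using f g unfolding h_def turn_like_def
    by (intro continuous_intros) (auto intro: continuous_on_subset)
  have "0 < f 0" and ff: "f (f 0) = 1" and gg: "g (g 0) = 1" and "strict_mono g"
    using f g by (auto simp: turn_like_def)
  have "\<exists>x. 0 \<le> x \<and> x \<le> f 0 \<and> h x = 0"
  proof (cases "h 0 \<le> 0")
    case True
    then have "g (f 0) \<le> g (g 0)"
      using \<open>strict_mono g\<close> by (simp add: h_def strict_mono_less_eq)
    then have "0 \<le> h (f 0)" using ff gg by (simp add: h_def)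
    with True show ?thesis using IVT'[of h 0 0 "f 0"] \<open>0 < f 0\<close> cont by auto
  next
    case False
    then have "g (g 0) \<le> g (f 0)"
      using \<open>strict_mono g\<close> by (simp add: h_def strict_mono_less_eq)
    then have "h (f 0) \<le> 0" using ff gg by (simp add: h_def)
    with False show ?thesis using IVT2'[of h "f 0" 0 0] \<open>0 < f 0\<close> cont by auto
  qed
  then show ?thesis by (auto simp: h_def)
qed

lemma continuous_nonzero_pos:
  fixes h :: "real \<Rightarrow> real"
  assumes "continuous_on UNIV h" "\<And>x. h x \<noteq> 0" "h z > 0"
  shows "h x > 0"
proof (rule ccontr)
  assume "\<not> h x > 0"
  moreover have "connected (range h)"
    using assms(1) by (intro connected_continuous_image) auto
  ultimately have "0 \<in> range h" using assms(3) connectedD_interval[of "range h" "h x" "h z" 0] by auto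
  with assms(2) show False by force
qed

text \<open>At a point where \<^term>\<open>f\<close> and \<^term>\<open>g\<close> agree (an endpoint of the chord through the two centres)
  the composition of \<^term>\<open>f\<close> and \<^term>\<open>g\<close> is a shift by 1, which decides the sign everywhere.\<close>
lemma turn_like_word3_gt:
  assumes f: "turn_like f" and g: "turn_like g" and h: "turn_like h"
    and neq: "\<And>x. h (g (f x)) \<noteq> x + 1"
  shows "h (g (f x)) > x + 1"
proof -
  obtain z where "f z = g z" using turn_like_coincide[OF f g] by blast
  then have "g (f z) = z + 1" using g by (simp add: turn_like_def)
  then have z: "h (g (f z)) - (z + 1) > 0" using h by (simp add: turn_like_def)
  have "continuous_on UNIV (\<lambda>x. h (g (f x)) - (x + 1))"
    using f g h unfolding turn_like_def
    by (intro continuous_intros) (auto intro!: continuous_on_compose2[of UNIV h] continuous_on_compose2[of UNIV g])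
  from continuous_nonzero_pos[OF this _ z, of x] neq show ?thesis by simp
qed

lemma turn_like_word5_gt:
  assumes f: "turn_like f" and g: "turn_like g" and h: "turn_like h"
    and neq: "\<And>x. h (g (f (g (f x)))) \<noteq> x + 2"
  shows "h (g (f (g (f x)))) > x + 2"
proof -
  obtain z where "f z = g z" using turn_like_coincide[OF f g] by blast
  then have gf: "g (f z) = z + 1" using g by (simp add: turn_like_def)
  then have "h (g (f (g (f z)))) = h z + 2"
    using turn_like_add_one[OF f] turn_like_add_one[OF g] turn_like_add_one[OF h, of "z + 1"]
      turn_like_add_one[OF h, of z] by simp
  then have z: "h (g (f (g (f z)))) - (z + 2) > 0" using h by (simp add: turn_like_def)
  have "continuous_on UNIV (\<lambda>x. h (g (f (g (f x)))) - (x + 2))"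
    using f g h unfolding turn_like_def
    by (intro continuous_intros) (auto intro!: continuous_on_compose2[of UNIV h]
        continuous_on_compose2[of UNIV g] continuous_on_compose2[of UNIV f])
  from continuous_nonzero_pos[OF this _ z, of x] neq show ?thesis by simp
qed

section \<open>Cyclic rotation and cancellation of words\<close>

lemma turn_like_conjugate_gt:
  assumes f: "turn_like f" and gt: "\<And>x. x + of_int k < w (f x)"
  shows "x + of_int k < f (w x)"
proof -
  have add: "f (y + of_int j) = f y + of_int j" for y j
    by (rule degree_one_add_int) (rule turn_like_add_one[OF f])
  \<comment> \<open>The preimage of \<open>x\<close> under \<open>f\<close>, since
    \<open>f (f x) = x + 1\<close>.\<close>
  define z where "z = f x - 1"
  have z: "f z = x" using f add[of "f x" "-1"] by (simp add: z_def turn_like_def)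
  have "f (z + of_int k) < f (w x)"
    using f gt[of z] z by (simp add: turn_like_def strict_mono_less)
  then show ?thesis using z by (simp add: add)
qed

text \<open>Two equal letters among three are always cyclic neighbours. Rotated to the front they
  act as a shift by 1, and the remaining letter moves every point forward.\<close>

lemma cyclic_word3_gt:
  fixes T :: "nat \<Rightarrow> real \<Rightarrow> real"
  assumes T: "\<And>i. i \<in> {1, 2, 3} \<Longrightarrow> turn_like (T i)"
    and distinct3: "\<And>i j k x. {i, j, k} = {1, 2, 3} \<Longrightarrow> T k (T j (T i x)) > x + 1"
    and ijk: "i \<in> {1, 2, 3}" "j \<in> {1, 2, 3}" "k \<in> {1, 2, 3}"
  shows "T k (T j (T i x)) > x + 1"
proof -
  define W where "W i j k \<longleftrightarrow> (\<forall>x. T k (T j (T i x)) > x + 1)" for i j k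
  have rot: "W j k i" if "W i j k" "i \<in> {1, 2, 3}" for i j k
    using turn_like_conjugate_gt[OF T[OF that(2)], of 1 "\<lambda>x. T k (T j x)"] that(1)
    by (simp add: W_def)
  have rep: "W i i k" if "i \<in> {1, 2, 3}" "k \<in> {1, 2, 3}" for i k
    using T[OF that(1)] T[OF that(2)] by (simp add: W_def turn_like_def)
  have "i = j \<or> j = k \<or> k = i \<or> {i, j, k} = {1, 2, 3}" using ijk by auto
  then have "W i j k"
  proof (elim disjE)
    assume "i = j" then show ?thesis using rep ijk by simp
  next
    assume "j = k" then show ?thesis using rot[OF rot[OF rep]] ijk by simp
  next
    assume "k = i" then show ?thesis using rot[OF rep] ijk by simp
  next
    assume "{i, j, k} = {1, 2, 3}" then show ?thesis using distinct3 by (simp add: W_def)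
  qed
  then show ?thesis by (simp add: W_def)
qed

text \<open>A cyclic word of length five in three letters without equal cyclic neighbours is a rotation
  of a word of the form ijijk with distinct letters.\<close>
lemma cyclic_word5_gt:
  fixes T :: "nat \<Rightarrow> real \<Rightarrow> real"
  assumes T: "\<And>i. i \<in> {1, 2, 3} \<Longrightarrow> turn_like (T i)"
    and word3: "\<And>i j k x. {i, j, k} = {1, 2, 3} \<Longrightarrow> T k (T j (T i x)) > x + 1"
    and word5: "\<And>i j k x. {i, j, k} = {1, 2, 3} \<Longrightarrow> T k (T j (T i (T j (T i x)))) > x + 2"
    and idx: "a \<in> {1, 2, 3}" "b \<in> {1, 2, 3}" "c \<in> {1, 2, 3}" "d \<in> {1, 2, 3}" "e \<in> {1, 2, 3}"
  shows "T e (T d (T c (T b (T a x)))) > x + 2"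
proof -
  define W where "W a b c d e \<longleftrightarrow> (\<forall>x. T e (T d (T c (T b (T a x)))) > x + 2)" for a b c d e
  have rot: "W b c d e a" if "W a b c d e" "a \<in> {1, 2, 3}" for a b c d e
    using turn_like_conjugate_gt[OF T[OF that(2)], of 2 "\<lambda>x. T e (T d (T c (T b x)))"] that(1)
    by (simp add: W_def)
  have rep: "W a a c d e" if "a \<in> {1, 2, 3}" "c \<in> {1, 2, 3}" "d \<in> {1, 2, 3}" "e \<in> {1, 2, 3}" for a c d e
  proof -
    have "T a (T a x) = x + 1" for x using T[OF that(1)] by (simp add: turn_like_def)
    moreover have "T e (T d (T c (x + 1))) > (x + 1) + 1" for x
      by (rule cyclic_word3_gt[OF T word3]) (use that in auto)
    ultimately show ?thesis by (simp add: W_def add.assoc)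
  qed
  have alt: "W i j i j k" if "{i, j, k} = {1, 2, 3}" for i j k
    using word5[OF that] by (simp add: W_def)
  \<comment> \<open>Four rotations of a five-letter word undo one.\<close>
  have unrot: "W a b c d e"
    if "W b c d e a" "b \<in> {1, 2, 3}" "c \<in> {1, 2, 3}" "d \<in> {1, 2, 3}" "e \<in> {1, 2, 3}" for a b c d e
    by (rule rot[OF rot[OF rot[OF rot]]]) (use that in blast)+
  have first: "W a b c d e" if "a = b \<or> (a = c \<and> b = d \<and> b \<noteq> e \<and> e \<noteq> a)"
    "a \<in> {1, 2, 3}" "b \<in> {1, 2, 3}" "c \<in> {1, 2, 3}" "d \<in> {1, 2, 3}" "e \<in> {1, 2, 3}" for a b c d e
  proof (cases "a = b")
    case False
    then have "{a, b, e} = {1, 2, 3}" using that by auto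
    then show ?thesis using alt False that(1) by blast
  qed (use rep that in blast)
  \<comment> \<open>One case for each starting position. If no cyclic neighbours agree, the three
    letters occur 2, 2 and 1 times, and the four places other than the single one alternate.\<close>
  consider "a = b \<or> (a = c \<and> b = d \<and> b \<noteq> e \<and> e \<noteq> a)" | "b = c \<or> (b = d \<and> c = e \<and> c \<noteq> a \<and> a \<noteq> b)"
    | "c = d \<or> (c = e \<and> d = a \<and> d \<noteq> b \<and> b \<noteq> c)" | "d = e \<or> (d = a \<and> e = b \<and> e \<noteq> c \<and> c \<noteq> d)"
    | "e = a \<or> (e = b \<and> a = c \<and> a \<noteq> d \<and> d \<noteq> e)"
    using idx by (smt (verit) insert_iff empty_iff)
  then have "W a b c d e"
  proof cases
    case 1
    then show ?thesis using first idx by blast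
  next
    case 2
    then have "W b c d e a" using first idx by blast
    then show ?thesis using unrot idx by blast
  next
    case 3
    then have "W c d e a b" using first idx by blast
    then have "W b c d e a" using unrot idx by blast
    then show ?thesis using unrot idx by blast
  next
    case 4
    then have "W d e a b c" using first idx by blast
    then have "W c d e a b" using unrot idx by blast
    then have "W b c d e a" using unrot idx by blast
    then show ?thesis using unrot idx by blast
  next
    case 5
    then have "W e a b c d" using first idx by blast
    then show ?thesis using rot idx by blast
  qed
  then show ?thesis by (simp add: W_def)
qed

subsection \<open>The triangle\<close>

lemma real_multiple_of_Im_zero:
  assumes "Im (cnj d * z) = 0" "d \<noteq> 0"
  shows "\<exists>t. z = of_real t * d"
proof -
  have "of_real ((cmod d)\<^sup>2) * z = d * (cnj d * z)" by (simp only: complex_norm_square mult.assoc)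
  also have "cnj d * z = of_real (Re (cnj d * z))" using assms(1) by (simp only: complex_eq_iff) simp
  finally have "z = of_real (Re (cnj d * z) / (cmod d)\<^sup>2) * d"
    using assms(2) by (simp add: field_simps)
  then show ?thesis by blast
qed

lemma collinear_tri_det_zero:
  assumes "tri_det A B C = 0"
  shows "collinear {A, B, C}"
proof (cases "A = B")
  case False
  then obtain t where "C - A = of_real t * (B - A)"
    using real_multiple_of_Im_zero[of "B - A" "C - A"] assms by (auto simp: tri_det_def)
  then have "C = t *\<^sub>R B + (1 - t) *\<^sub>R A" by (simp add: scaleR_conv_of_real algebra_simps)
  then have "collinear {B, C, A}" unfolding collinear_3_expand by blast
  then show ?thesis by (simp add: insert_commute)
qed (simp add: insert_commute)

lemma Im_cnj_mult_inner: "Im (cnj d * u) = (\<i> * d) \<bullet> u"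
  by (simp add: inner_complex_def)

text \<open>Half-planes are convex, so vertices suffice: \<open>V\<close> is not to the right of the
  chord from \<open>circ x\<close> to \<open>circ y\<close> iff
  \<open>y \<le> turn_lift V x\<close>. That the line meets the triangle makes \<open>y\<close> the
  largest value admissible for all vertices.\<close>

lemma psi_triangle:
  assumes "cmod A < 1" "cmod B < 1" "cmod C < 1"
  shows "psi (convex hull {A, B, C}) (circ x)
    = circ (min (turn_lift A x) (min (turn_lift B x) (turn_lift C x)))"
proof -
  define y0 where "y0 = min (turn_lift A x) (min (turn_lift B x) (turn_lift C x))"
  have y0: "x < y0" "y0 < x + 1"
    using turn_lift_bounds[OF assms(1), of x] turn_lift_bounds[OF assms(2), of x]
      turn_lift_bounds[OF assms(3), of x] by (auto simp: y0_def)
  define side where "side y u = Im (cnj (circ y - circ x) * (u - circ x))" for y u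
  have side_vertex: "sgn (side y V) = sgn (turn_lift V x - y)"
    if "V \<in> {A, B, C}" "x < y" "y < x + 1" for y V
    using sgn_orientation_turn_lift[of V x y] that assms by (auto simp: side_def)
  have half: "{u. side y u \<ge> 0} = {u. (\<i> * (circ y - circ x)) \<bullet> u \<ge> (\<i> * (circ y - circ x)) \<bullet> circ x}"
    "{u. side y u > 0} = {u. (\<i> * (circ y - circ x)) \<bullet> u > (\<i> * (circ y - circ x)) \<bullet> circ x}" for y
    unfolding side_def Im_cnj_mult_inner by (auto simp: inner_diff_right)
  have convex: "convex {u. side y u \<ge> 0}" "convex {u. side y u > 0}" for y
    unfolding half by (rule convex_halfspace_ge convex_halfspace_gt)+
  have neq: "circ y \<noteq> circ x" if "x < y" "y < x + 1" for y
  proof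
    assume "circ y = circ x"
    then obtain k :: int where "y = x + of_int k" by (auto simp: circ_eq_iff)
    then have "(0::real) < of_int k" "of_int k < (1::real)" using that by linarith+
    then show False by simp
  qed
  have "(THE w. w \<in> sphere 0 1 \<and> w \<noteq> circ x \<and> line_through (circ x) w \<inter> convex hull {A, B, C} \<noteq> {}
      \<and> (\<forall>u\<in>convex hull {A, B, C}. left_of (circ x) w u)) = circ y0"
  proof (rule the_equality, intro conjI)
    show "circ y0 \<in> sphere 0 1" by simp
    show "circ y0 \<noteq> circ x" using neq[OF y0] .
    have "\<exists>V\<in>{A, B, C}. turn_lift V x = y0" by (auto simp: y0_def min_def)
    then obtain V where V: "V \<in> {A, B, C}" "turn_lift V x = y0" by blast
    then have "side y0 V = 0" using side_vertex[OF V(1) y0] by (simp add: sgn_0_0)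
    then obtain t where "V - circ x = of_real t * (circ y0 - circ x)"
      using real_multiple_of_Im_zero neq[OF y0] unfolding side_def by (metis right_minus_eq)
    then have "V \<in> line_through (circ x) (circ y0)"
      unfolding line_through_def by (auto simp: algebra_simps intro!: exI[of _ t])
    moreover have "V \<in> convex hull {A, B, C}" using V(1) by (rule hull_inc)
    ultimately show "line_through (circ x) (circ y0) \<inter> convex hull {A, B, C} \<noteq> {}" by blast
    have "side y0 W \<ge> 0" if "W \<in> {A, B, C}" for W
    proof -
      have "turn_lift W x - y0 \<ge> 0" using that by (auto simp: y0_def)
      then show ?thesis using side_vertex[OF that y0] by (metis sgn_real_def order.trans zero_le_sgn_iff)
    qed
    then have "convex hull {A, B, C} \<subseteq> {u. side y0 u \<ge> 0}"
      by (intro hull_minimal convex) blast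
    then show "\<forall>u\<in>convex hull {A, B, C}. left_of (circ x) (circ y0) u"
      by (auto simp: left_of_def side_def)
  next
    fix w
    assume w: "w \<in> sphere 0 1 \<and> w \<noteq> circ x \<and> line_through (circ x) w \<inter> convex hull {A, B, C} \<noteq> {}
      \<and> (\<forall>u\<in>convex hull {A, B, C}. left_of (circ x) w u)"
    then obtain y where y: "w = circ y" "x < y" "y < x + 1"
      using sphere_eq_circ[of w x] by auto
    have "y \<le> turn_lift W x" if "W \<in> {A, B, C}" for W
    proof -
      have "side y W \<ge> 0" using w y(1) hull_inc[OF that, of convex] by (auto simp: left_of_def side_def)
      then show ?thesis using side_vertex[OF that y(2,3)] by (metis diff_ge_0_iff_ge zero_le_sgn_iff)
    qed
    then have "y \<le> y0" by (simp add: y0_def)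
    moreover have "\<not> y < y0"
    proof
      assume "y < y0"
      have "side y W > 0" if "W \<in> {A, B, C}" for W
      proof -
        have "turn_lift W x - y > 0" using that \<open>y < y0\<close> by (auto simp: y0_def)
        then show ?thesis using side_vertex[OF that y(2,3)] by (metis sgn_greater)
      qed
      \<comment> \<open>The open half-plane is convex too, so the whole triangle would miss the
        line.\<close>
      then have "convex hull {A, B, C} \<subseteq> {u. side y u > 0}"
        by (intro hull_minimal convex) blast
      moreover obtain u t where "u \<in> convex hull {A, B, C}" "u = circ x + of_real t * (circ y - circ x)"
        using w y(1) by (auto simp: line_through_def)
      moreover have "side y (circ x + of_real t * (circ y - circ x)) = 0"
        by (simp add: side_def algebra_simps)
      ultimately show False by force
    qed
    ultimately show "w = circ y0" using y(1) by simp
  qed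
  then show ?thesis by (simp add: psi_def y0_def)
qed

text \<open>\<open>rot_num\<close> selects the lift by a definite description. The difference of two
  lifts is continuous and integer-valued, and the normalization makes it vanish at 0.\<close>

lemma is_lift_unique:
  assumes "is_lift f F" "is_lift f G"
  shows "F = G"
proof
  fix x
  have cont: "continuous_on UNIV (\<lambda>x. F x - G x)"
    using assms by (auto simp: is_lift_def intro: continuous_on_diff)
  have int: "\<exists>k::int. F x - G x = of_int k" for x
  proof -
    have "circ (F x) = circ (G x)" using assms by (simp add: is_lift_def)
    then show ?thesis by (auto simp: circ_eq_iff)
  qed
  obtain k :: int where k: "F x - G x = of_int k" using int by blast
  obtain l :: int where l: "F 0 - G 0 = of_int l" using int by blast
  have "\<bar>F 0 - G 0\<bar> < 1" using assms by (auto simp: is_lift_def)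
  then have "l = 0" using l by linarith
  then have zero: "0 \<in> range (\<lambda>x. F x - G x)" using l rangeI[of "\<lambda>x. F x - G x" 0] by simp
  have conn: "connected (range (\<lambda>x. F x - G x))"
    using cont by (intro connected_continuous_image) auto
  have half: "r \<notin> range (\<lambda>x. F x - G x)" if "\<bar>r\<bar> = 1 / 2" for r
  proof
    assume "r \<in> range (\<lambda>x. F x - G x)"
    then obtain m :: int where "r = of_int m" using int by blast
    with that have "of_int (2 * \<bar>m\<bar>) = (1::real)" by (simp only: of_int_mult of_int_abs of_int_numeral)
    then have "2 * \<bar>m\<bar> = 1" by (simp only: of_int_eq_1_iff)
    then show False by presburger
  qed
  have mem: "of_int k \<in> range (\<lambda>x. F x - G x)" using k rangeI[of "\<lambda>x. F x - G x" x] by simp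
  have "k = 0"
  proof (rule ccontr)
    assume "k \<noteq> 0"
    then consider "k \<ge> 1" | "k \<le> -1" by linarith
    then show False
    proof cases
      case 1
      then show False using connectedD_interval[OF conn zero mem, of "1 / 2"] half[of "1 / 2"] by linarith
    next
      case 2
      then show False using connectedD_interval[OF conn mem zero, of "- 1 / 2"] half[of "- 1 / 2"] by linarith
    qed
  qed
  then show "F x = G x" using k by simp
qed

theorem theorem5p3:
  fixes P :: "nat \<Rightarrow> complex"
  assumes "\<forall>i\<in>{1,2,3}. P i \<in> ball 0 1"
    and "\<not> collinear {P 1, P 2, P 3}"
    and "\<forall>i j k. {i, j, k} = {1, 2, 3::nat} \<longrightarrow> DeltaK 2 (P i) (P j) > deltaK (P i) (P j) (P k)"
  shows "rot_num (psi (convex hull {P 1, P 2, P 3})) > 2 / 5"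
proof -
  define T where "T i = turn_lift (P i)" for i
  have ball: "cmod (P i) < 1" if "i \<in> {1, 2, 3}" for i using assms(1) that by auto
  have T: "turn_like (T i)" if "i \<in> {1, 2, 3}" for i
    using ball[OF that] by (simp add: T_def turn_like_turn_lift)
  have words: "T k (T j (T i x)) > x + 1 \<and> T k (T j (T i (T j (T i x)))) > x + 2"
    if ijk: "{i, j, k} = {1, 2, 3}" for i j k x
  proof -
    have idx: "i \<in> {1, 2, 3}" "j \<in> {1, 2, 3}" "k \<in> {1, 2, 3}" using ijk by auto
    have "P ` {i, j, k} = P ` {1, 2, 3}" using ijk by simp
    then have "{P i, P j, P k} = {P 1, P 2, P 3}" by simp
    then have det: "tri_det (P i) (P j) (P k) \<noteq> 0"
      using collinear_tri_det_zero[of "P i" "P j" "P k"] assms(2) by metis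
    then have "P i \<noteq> P j" by (auto simp: tri_det_def)
    from det have small5: "4 * (1 - P i \<bullet> P j)\<^sup>2 * (tri_det (P i) (P j) (P k))\<^sup>2
        < (1 - (cmod (P i))\<^sup>2)\<^sup>2 * (1 - (cmod (P j))\<^sup>2)\<^sup>2 * (1 - (cmod (P k))\<^sup>2)"
      using Delta_delta_imp_tri_det[OF ball ball ball] idx assms(3) ijk by simp
    \<comment> \<open>The five-letter bound implies the three-letter one, because positivity of the
      Klein form gives \<open>n \<le> (1 - P i \<bullet> P j)\<^sup>2\<close>.\<close>
    have small3: "(tri_det (P i) (P j) (P k))\<^sup>2
        < (1 - (cmod (P i))\<^sup>2) * (1 - (cmod (P j))\<^sup>2) * (1 - (cmod (P k))\<^sup>2)"
    proof -
      define n where "n = (1 - (cmod (P i))\<^sup>2) * (1 - (cmod (P j))\<^sup>2)"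
      define q where "q = (tri_det (P i) (P j) (P k))\<^sup>2"
      have "n > 0" using one_minus_norm_square_pos ball idx unfolding n_def by (intro mult_pos_pos) auto
      have "n \<le> (1 - P i \<bullet> P j)\<^sup>2"
        using klein_form_pos[of "P i" "P j - P i"] ball[OF idx(1)] \<open>P i \<noteq> P j\<close>
        by (simp add: klein_form_chord n_def)
      then have "n * q \<le> (1 - P i \<bullet> P j)\<^sup>2 * q" unfolding q_def by (intro mult_right_mono) auto
      moreover have "0 \<le> n * q" using \<open>n > 0\<close> by (simp add: q_def)
      ultimately have "n * q < n * (n * (1 - (cmod (P k))\<^sup>2))"
        using small5 by (simp add: n_def q_def power2_eq_square algebra_simps)
      then have "q < n * (1 - (cmod (P k))\<^sup>2)" using \<open>n > 0\<close> by simp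
      then show ?thesis by (simp add: n_def q_def)
    qed
    \<comment> \<open>An integer shift of \<open>x\<close> would project to a fixed point of the
      composed half-turns on the circle.\<close>
    have neq3: "T k (T j (T i x)) \<noteq> x + 1" for x
    proof
      assume "T k (T j (T i x)) = x + 1"
      then have "circ (T k (T j (T i x))) = circ x"
        unfolding circ_eq_iff by (intro exI[of _ 1]) simp
      then show False
        using half_turn3_no_fixed_point[OF _ _ _ norm_circ small3] ball idx
        by (simp add: T_def circ_turn_lift)
    qed
    have neq5: "T k (T j (T i (T j (T i x)))) \<noteq> x + 2" for x
    proof
      assume "T k (T j (T i (T j (T i x)))) = x + 2"
      then have "circ (T k (T j (T i (T j (T i x))))) = circ x"
        unfolding circ_eq_iff by (intro exI[of _ 2]) simp
      then show False
        using half_turn5_no_fixed_point[OF _ _ _ norm_circ small5] ball idx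
        by (simp add: T_def circ_turn_lift)
    qed
    show ?thesis
      using turn_like_word3_gt[of "T i" "T j" "T k" x] turn_like_word5_gt[of "T i" "T j" "T k" x]
        T idx neq3 neq5 by blast
  qed
  define F where "F x = min (T 1 x) (min (T 2 x) (T 3 x))" for x
  have F1: "F (x + 1) = F x + 1" for x
    using T by (simp add: F_def turn_like_add_one min_add_distrib_left)
  have contF: "continuous_on UNIV F"
    using T unfolding F_def turn_like_def by (intro continuous_on_min) auto
  have "mono F"
    using T unfolding F_def turn_like_def
    by (intro monoI min.mono) (auto simp: strict_mono_less_eq)
  have "is_lift (psi (convex hull {P 1, P 2, P 3})) F"
    using F1 contF psi_triangle[of "P 1" "P 2" "P 3"] ball turn_lift_bounds[of "P 1" 0]
      turn_lift_bounds[of "P 2" 0] turn_lift_bounds[of "P 3" 0]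
    by (auto simp: is_lift_def F_def T_def)
  then have "(THE F. is_lift (psi (convex hull {P 1, P 2, P 3})) F) = F"
    using is_lift_unique by blast
  moreover have "(F ^^ 5) x > x + 2" for x
  proof -
    \<comment> \<open>The index attaining the minimum varies along the orbit, so five steps of
      \<open>F\<close> may spell any word in the three letters.\<close>
    have step: "\<exists>i\<in>{1, 2, 3}. F y = T i y" for y by (auto simp: F_def min_def)
    obtain a where a: "a \<in> {1, 2, 3}" "F x = T a x" using step by blast
    obtain b where b: "b \<in> {1, 2, 3}" "F (T a x) = T b (T a x)" using step by blast
    obtain c where c: "c \<in> {1, 2, 3}" "F (T b (T a x)) = T c (T b (T a x))" using step by blast
    obtain d where d: "d \<in> {1, 2, 3}" "F (T c (T b (T a x))) = T d (T c (T b (T a x)))" using step by blast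
    obtain e where e: "e \<in> {1, 2, 3}" "F (T d (T c (T b (T a x)))) = T e (T d (T c (T b (T a x))))"
      using step by blast
    have "(F ^^ 5) x = T e (T d (T c (T b (T a x))))"
      by (simp add: numeral_eq_Suc a b c d e)
    moreover have "T e (T d (T c (T b (T a x)))) > x + 2"
      by (rule cyclic_word5_gt[OF T]) (use words a b c d e in auto)
    ultimately show ?thesis by simp
  qed
  then have "lim (\<lambda>n. (F ^^ n) 0 / real n) > 2 / real 5"
    using translation_number_gt[OF \<open>mono F\<close> F1 contF, of 5 2] by simp
  ultimately show ?thesis by (simp add: rot_num_def)
qed

end
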